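(* Let $p\in(1,+\infty)$, let $\alpha<\beta$ be real numbers, and let $V(t)=\frac{|(t-\alpha)(t-\beta)|^p}{p}$ for $t\in\mathbb{R}$. Then the unique solution $q$ of the problem $$-\left(|u'|^{p-2}u'\right)'+V'(u)=0\ \text{ in }\mathbb{R},\qquad u(0)=\frac{\alpha+\beta}{2},\qquad u(-\infty)=\alpha,\qquad u(+\infty)=\beta,$$ is given by $$q(t)=\frac{\alpha+\beta e^{\frac{(\beta-\alpha)t}{\sqrt[p]{p-1}}}}{1+e^{\frac{(\beta-\alpha)t}{\sqrt[p]{p-1}}}}.$$
   Context: $u(\pm\infty)$ denotes $\lim_{t\to\pm\infty}u(t)$. The expression $|s|^{p-2}s$ is read as $0$ at $s=0$. Solutions are understood as functions in $C^{1,\gamma}_{\mathrm{loc}}(\mathbb{R})$ for some $\gamma\in(0,1)$ satisfying the equation. *)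

theory Defs
  imports "HOL-Analysis.Analysis"
begin

definition C1_loc_Holder :: "real \<Rightarrow> (real \<Rightarrow> real) \<Rightarrow> bool" where
  "C1_loc_Holder \<gamma> u \<longleftrightarrow>
     (\<forall>t. u differentiable (at t)) \<and>
     (\<forall>K. compact K \<longrightarrow>
        (\<exists>C. \<forall>x\<in>K. \<forall>y\<in>K. \<bar>deriv u x - deriv u y\<bar> \<le> C * \<bar>x - y\<bar> powr \<gamma>))"

text \<open>At \<open>s = 0\<close> the factor \<open>s\<close> gives the value \<open>0\<close>, also when \<open>p < 2\<close>.\<close>

definition p_flux :: "real \<Rightarrow> real \<Rightarrow> real" where
  "p_flux p s = \<bar>s\<bar> powr (p - 2) * s"

text \<open>
  The equation \<open>- (|u'|\<^sup>p\<^sup>-\<^sup>2 u')' + V'(u) = 0\<close> on the whole line. Only the flux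
  \<open>|u'|\<^sup>p\<^sup>-\<^sup>2 u'\<close> has to be differentiable; \<open>u\<close> itself need not be twice differentiable.
  Reading the outer derivative in the weak sense gives the same solutions whenever \<open>V'\<close> is
  continuous: a continuous function whose distributional derivative is continuous is \<open>C\<^sup>1\<close>,
  with that function as its pointwise derivative.
\<close>

definition p_Laplace_solution :: "real \<Rightarrow> (real \<Rightarrow> real) \<Rightarrow> (real \<Rightarrow> real) \<Rightarrow> bool" where
  "p_Laplace_solution p V u \<longleftrightarrow>
     (\<exists>\<gamma>. 0 < \<gamma> \<and> \<gamma> < 1 \<and> C1_loc_Holder \<gamma> u) \<and>
     (\<forall>t. (\<lambda>s. p_flux p (deriv u s)) differentiable (at t) \<and>
          - deriv (\<lambda>s. p_flux p (deriv u s)) t + deriv V (u t) = 0)"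

definition transition_solution ::
  "real \<Rightarrow> (real \<Rightarrow> real) \<Rightarrow> real \<Rightarrow> real \<Rightarrow> (real \<Rightarrow> real) \<Rightarrow> bool" where
  "transition_solution p V \<alpha> \<beta> u \<longleftrightarrow>
     p_Laplace_solution p V u \<and>
     u 0 = (\<alpha> + \<beta>) / 2 \<and>
     (u \<longlongrightarrow> \<alpha>) at_bot \<and>
     (u \<longlongrightarrow> \<beta>) at_top"

end

theory Submission
  imports Defs
begin

text \<open>
  Multiplying the equation by \<open>u'\<close> and integrating gives the conserved energy
  \<open>(p - 1)/p |u'|\<^sup>p - V(u)\<close>. Since \<open>u\<close> itself is not known to be twice differentiable, the
  kinetic term has to be differentiated as a function of the flux \<open>F = |u'|\<^sup>p\<^sup>-\<^sup>2 u'\<close>: with the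
  conjugate exponent \<open>r = p/(p - 1)\<close> one has \<open>(p - 1)/p |u'|\<^sup>p = |F|\<^sup>r/r\<close>, and the derivative of
  \<open>|s|\<^sup>r/r\<close> at \<open>F\<close> is \<open>|F|\<^sup>r\<^sup>-\<^sup>2 F = u'\<close>, because the two flux maps are inverse to each other.

  As \<open>u\<close> converges at \<open>+\<infinity>\<close>, the mean value theorem yields points tending to \<open>+\<infinity>\<close> at which
  \<open>u'\<close> tends to \<open>0\<close>, so the energy is \<open>-V(\<beta>) = 0\<close>
  (\<open>p_Laplace_first_integral\<close>). For the given \<open>V\<close> this reads
  \<open>\<kappa> |u'| = |(u - \<alpha>)(u - \<beta>)|\<close> with \<open>\<kappa>\<^sup>p = p - 1\<close>. The right-hand side is locally Lipschitz
  in \<open>u\<close> and vanishes at \<open>\<alpha>\<close> and \<open>\<beta>\<close>, so a solution starting at the midpoint never reaches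
  either well. Then \<open>u'\<close> has no zero, so it keeps one sign, which the limits force to be positive.
  What remains is the logistic equation \<open>\<kappa> u' = (u - \<alpha>)(\<beta> - u)\<close>, under which
  \<open>ln ((u - \<alpha>)/(\<beta> - u))\<close> grows linearly; this determines \<open>u\<close>.

  Conversely the logistic profile is smooth with positive derivative, and differentiating
  \<open>q'\<^sup>p\<^sup>-\<^sup>1\<close> along the logistic equation returns \<open>V'(q)\<close>.
\<close>

section \<open>The flux map and its potential\<close>

lemma p_flux_0 [simp]: "p_flux p 0 = 0"
  by (simp add: p_flux_def)

lemma p_flux_pos: "0 < s \<Longrightarrow> p_flux p s = s powr (p - 1)"
  using powr_add[of s "p - 2" 1] by (simp add: p_flux_def)

lemma p_flux_minus: "p_flux p (- s) = - p_flux p s"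
  by (simp add: p_flux_def)

lemma p_flux_pos_iff: "0 < p_flux p s \<longleftrightarrow> 0 < s"
  by (auto simp: p_flux_def zero_less_mult_iff)

lemma p_flux_eq_0_iff: "p_flux p s = 0 \<longleftrightarrow> s = 0"
  by (simp add: p_flux_def)

lemma abs_p_flux: "\<bar>p_flux p s\<bar> = \<bar>s\<bar> powr (p - 1)" if "s \<noteq> 0"
  using p_flux_pos[of "\<bar>s\<bar>" p] that by (simp add: p_flux_def abs_mult)

lemma abs_p_flux_powr_conjugate:
  assumes "1 < p"
  shows "\<bar>p_flux p s\<bar> powr (p / (p - 1)) = \<bar>s\<bar> powr p"
  using assms by (cases "s = 0") (simp_all add: abs_p_flux powr_powr)

text \<open>For positive arguments this is \<open>(p - 1)(r - 1) = 1\<close> with \<open>r = p/(p - 1)\<close>; both maps are odd.\<close>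

lemma p_flux_conjugate_inverse:
  assumes "1 < p"
  shows "p_flux (p / (p - 1)) (p_flux p s) = s"
proof -
  have pos: "p_flux (p / (p - 1)) (p_flux p s) = s" if "0 < s" for s
  proof -
    have "(p - 1) * (p / (p - 1) - 1) = 1"
      using assms by (simp add: field_simps)
    then show ?thesis
      using that p_flux_pos_iff[of p s] by (simp add: p_flux_pos powr_powr)
  qed
  consider "0 < s" | "s = 0" | "0 < - s" by linarith
  then show ?thesis
    by cases (use pos[of s] pos[of "- s"] in \<open>simp_all add: p_flux_minus\<close>)
qed

text \<open>
  At the origin the difference quotient is bounded by \<open>|h|\<^sup>p\<^sup>-\<^sup>1/p\<close>, which tends to \<open>0\<close> exactly
  because \<open>p > 1\<close>.
\<close>

lemma has_derivative_abs_powr: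
  assumes "1 < p"
  shows "((\<lambda>x. \<bar>x\<bar> powr p / p) has_real_derivative p_flux p x) (at x)"
proof -
  have pos: "((\<lambda>x. \<bar>x\<bar> powr p / p) has_real_derivative p_flux p x) (at x)" if "0 < x" for x
  proof (rule DERIV_cong_ev[THEN iffD1])
    show "((\<lambda>x. x powr p / p) has_real_derivative x powr (p - 1)) (at x)"
      using that assms by (auto intro!: derivative_eq_intros)
    show "\<forall>\<^sub>F y in nhds x. y powr p / p = \<bar>y\<bar> powr p / p"
      using that by (intro eventually_mono[OF eventually_nhds_in_open[of "{0<..}" x]]) auto
  qed (use that in \<open>simp_all add: p_flux_pos\<close>)
  consider "0 < x" | "x = 0" | "0 < - x" by linarith
  then show ?thesis
  proof cases
    case 1
    then show ?thesis by (rule pos)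
  next
    case 2
    have "((\<lambda>h. \<bar>h\<bar> powr (p - 1) / p) \<longlongrightarrow> 0) (at (0::real))"
      by (rule tendsto_eq_intros refl | use assms in simp)+
    then have "((\<lambda>h. (\<bar>h\<bar> powr p / p) / h) \<longlongrightarrow> 0) (at (0::real))"
    proof (rule Lim_null_comparison[rotated])
      have "norm (\<bar>h\<bar> powr p / p / h) \<le> \<bar>h\<bar> powr (p - 1) / p" if "h \<noteq> 0" for h
        using that assms by (simp add: abs_mult powr_diff field_simps)
      then show "\<forall>\<^sub>F h in at 0. norm (\<bar>h\<bar> powr p / p / h) \<le> \<bar>h\<bar> powr (p - 1) / p"
        by (auto simp: eventually_at_filter)
    qed
    then show ?thesis
      using 2 by (simp add: has_field_derivative_iff)
  next
    case 3
    have "((\<lambda>y. \<bar>- y\<bar> powr p / p) has_real_derivative p_flux p (- x) * - 1) (at x)"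
      by (rule DERIV_chain2[where f = "\<lambda>y. \<bar>y\<bar> powr p / p" and g = uminus, OF pos[OF 3]])
        (auto intro!: derivative_eq_intros)
    then show ?thesis by (simp add: p_flux_minus)
  qed
qed

section \<open>Conservation of energy\<close>

text \<open>
  The kinetic term is \<open>|F|\<^sup>r/r\<close> with \<open>F\<close> the flux and \<open>r = p/(p - 1)\<close>; its derivative is
  \<open>u' F' = u' V'(u)\<close>, which cancels that of \<open>V(u)\<close>.
\<close>

lemma p_Laplace_energy_constant:
  assumes p: "1 < p"
    and V: "\<And>x. V differentiable (at x)"
    and sol: "p_Laplace_solution p V u"
  shows "(p - 1) / p * \<bar>deriv u s\<bar> powr p - V (u s)
       = (p - 1) / p * \<bar>deriv u t\<bar> powr p - V (u t)"
proof -
  define r where "r = p / (p - 1)"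
  define F where "F = (\<lambda>t. p_flux p (deriv u t))"
  have r: "1 < r"
    using p by (simp add: r_def)
  have u': "(u has_real_derivative deriv u t) (at t)" for t
    using sol by (auto simp: p_Laplace_solution_def C1_loc_Holder_def
        DERIV_deriv_iff_real_differentiable)
  have F': "(F has_real_derivative deriv V (u t)) (at t)" for t
  proof -
    have "F differentiable (at t)" "deriv F t = deriv V (u t)"
      using sol by (simp_all add: p_Laplace_solution_def F_def)
    then show ?thesis
      using DERIV_deriv_iff_real_differentiable[of F t] by simp
  qed
  have "((\<lambda>t. \<bar>F t\<bar> powr r / r - V (u t)) has_real_derivative 0) (at t)" for t
  proof -
    have "((\<lambda>t. \<bar>F t\<bar> powr r / r) has_real_derivative p_flux r (F t) * deriv V (u t)) (at t)"
      by (rule DERIV_chain2[OF has_derivative_abs_powr[OF r] F'])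
    moreover have "p_flux r (F t) = deriv u t"
      by (simp add: r_def F_def p_flux_conjugate_inverse p)
    moreover have "((\<lambda>t. V (u t)) has_real_derivative deriv V (u t) * deriv u t) (at t)"
      using V by (intro DERIV_chain2[OF _ u']) (simp add: DERIV_deriv_iff_real_differentiable)
    ultimately show ?thesis
      using DERIV_diff by fastforce
  qed
  then have "\<bar>F s\<bar> powr r / r - V (u s) = \<bar>F t\<bar> powr r / r - V (u t)"
    by (intro DERIV_isconst_all) blast
  moreover have "\<bar>F t\<bar> powr r / r = (p - 1) / p * \<bar>deriv u t\<bar> powr p" for t
    using abs_p_flux_powr_conjugate[OF p] by (simp add: F_def r_def)
  ultimately show ?thesis by simp
qed

text \<open>
  Convergence of \<open>u\<close> does not give convergence of \<open>u'\<close> directly. It is enough to follow \<open>u'\<close> along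
  the mean value points of the intervals \<open>[n, n + 1]\<close>, where it equals \<open>u (n + 1) - u n\<close>.
\<close>

lemma p_Laplace_first_integral:
  assumes p: "1 < p"
    and V: "\<And>x. V differentiable (at x)"
    and sol: "p_Laplace_solution p V u"
    and lim: "(u \<longlongrightarrow> b) at_top"
  shows "(p - 1) / p * \<bar>deriv u t\<bar> powr p = V (u t) - V b"
proof -
  have u': "(u has_real_derivative deriv u t) (at t)" for t
    using sol by (auto simp: p_Laplace_solution_def C1_loc_Holder_def
        DERIV_deriv_iff_real_differentiable)
  have "\<exists>z. real n < z \<and> deriv u z = u (real n + 1) - u (real n)" for n
    using MVT2[of "real n" "real n + 1" u "deriv u"] u' by force
  then obtain z where z: "\<And>n. real n < z n"
    "\<And>n. deriv u (z n) = u (real n + 1) - u (real n)"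
    by metis
  have z_top: "filterlim z at_top sequentially"
    by (intro filterlim_at_top_mono[OF filterlim_real_sequentially] always_eventually allI
        less_imp_le z(1))
  have top1: "filterlim (\<lambda>n. real n + 1) at_top sequentially"
    by (rule filterlim_at_top_mono[OF filterlim_real_sequentially]) auto
  have "(\<lambda>n. u (real n + 1) - u (real n)) \<longlonglongrightarrow> b - b"
    by (intro tendsto_diff filterlim_compose[OF lim top1]
        filterlim_compose[OF lim filterlim_real_sequentially])
  then have "(\<lambda>n. \<bar>deriv u (z n)\<bar>) \<longlonglongrightarrow> 0"
    by (simp add: z(2) tendsto_rabs_zero)
  then have kin: "(\<lambda>n. \<bar>deriv u (z n)\<bar> powr p) \<longlonglongrightarrow> 0"
    using tendsto_powr2[OF _ tendsto_const, of "\<lambda>n. \<bar>deriv u (z n)\<bar>" 0 sequentially p] p by simp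
  have "isCont V b"
    using V by (simp add: differentiable_imp_continuous_within)
  then have "(\<lambda>n. V (u (z n))) \<longlonglongrightarrow> V b"
    by (rule isCont_tendsto_compose[OF _ filterlim_compose[OF lim z_top]])
  then have "(\<lambda>n. (p - 1) / p * \<bar>deriv u (z n)\<bar> powr p - V (u (z n)))
      \<longlonglongrightarrow> (p - 1) / p * 0 - V b"
    by (intro tendsto_diff tendsto_mult tendsto_const kin)
  moreover have "(p - 1) / p * \<bar>deriv u (z n)\<bar> powr p - V (u (z n))
      = (p - 1) / p * \<bar>deriv u t\<bar> powr p - V (u t)" for n
    by (rule p_Laplace_energy_constant[OF p V sol])
  ultimately have "(p - 1) / p * \<bar>deriv u t\<bar> powr p - V (u t) = - V b"
    using LIMSEQ_unique[OF tendsto_const] by fastforce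
  then show ?thesis by linarith
qed

section \<open>Solutions never reach an equilibrium\<close>

text \<open>
  The Gronwall argument: \<open>f\<^sup>2 e\<^sup>-\<^sup>2\<^sup>C\<^sup>t\<close> is nonincreasing and \<open>f\<^sup>2 e\<^sup>2\<^sup>C\<^sup>t\<close> is nondecreasing, so a zero
  spreads in both directions.
\<close>

lemma zero_spreads_if_deriv_le_self:
  fixes f f' :: "real \<Rightarrow> real"
  assumes der: "\<And>t. (f has_real_derivative f' t) (at t)"
    and bound: "\<And>t. t \<in> {a..b} \<Longrightarrow> \<bar>f' t\<bar> \<le> C * \<bar>f t\<bar>"
    and zero: "s \<in> {a..b}" "f s = 0" and t: "t \<in> {a..b}"
  shows "f t = 0"
proof -
  have main: "\<bar>f x * f' x\<bar> \<le> C * (f x)\<^sup>2" if "x \<in> {a..b}" for x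
    using mult_left_mono[OF bound[OF that], of "\<bar>f x\<bar>"]
    by (simp add: abs_mult power2_eq_square mult.left_commute)
  have der_exp: "((\<lambda>x. (f x)\<^sup>2 * exp (k * x)) has_real_derivative
      (2 * (f x * f' x) + k * (f x)\<^sup>2) * exp (k * x)) (at x)" for k x
    by (rule derivative_eq_intros der refl | simp add: algebra_simps)+
  define G where "G k x = (f x)\<^sup>2 * exp (k * x)" for k x
  have G': "\<exists>y. (G k has_real_derivative y) (at x) \<and> P y"
    if "P ((2 * (f x * f' x) + k * (f x)\<^sup>2) * exp (k * x))" for k x P
    using der_exp[of k x] that unfolding G_def by blast
  have "G k t \<le> 0" if k: "k = (if s \<le> t then - 2 * C else 2 * C)" for k
  proof (cases "s \<le> t")
    case True
    have "G k t \<le> G k s"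
    proof (rule DERIV_nonpos_imp_nonincreasing[OF True])
      fix x assume "s \<le> x" "x \<le> t"
      then have "2 * (f x * f' x) + k * (f x)\<^sup>2 \<le> 0"
        using main[of x] zero(1) t True by (simp add: k)
      then show "\<exists>y. (G k has_real_derivative y) (at x) \<and> y \<le> 0"
        by (intro G' mult_nonpos_nonneg exp_ge_zero)
    qed
    then show ?thesis using zero(2) by (simp add: G_def)
  next
    case False
    have "G k t \<le> G k s"
    proof (rule DERIV_nonneg_imp_nondecreasing[of t s "G k"])
      show "t \<le> s" using False by simp
    next
      fix x assume "t \<le> x" "x \<le> s"
      then have "0 \<le> 2 * (f x * f' x) + k * (f x)\<^sup>2"
        using main[of x] zero(1) t False by (simp add: k)
      then show "\<exists>y. (G k has_real_derivative y) (at x) \<and> 0 \<le> y"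
        by (intro G' mult_nonneg_nonneg exp_ge_zero)
    qed
    then show ?thesis using zero(2) by (simp add: G_def)
  qed
  then show ?thesis
    by (auto simp: G_def mult_le_0_iff split: if_splits)
qed

text \<open>
  The factor \<open>g\<close> is bounded on the compact interval between the two times, so there
  \<open>|u'|\<close> is at most a constant multiple of the distance of \<open>u\<close> to the equilibrium \<open>c\<close>.
\<close>

lemma equilibrium_not_reached:
  fixes u u' g :: "real \<Rightarrow> real"
  assumes der: "\<And>t. (u has_real_derivative u' t) (at t)"
    and g: "continuous_on UNIV g"
    and bound: "\<And>t. \<bar>u' t\<bar> \<le> \<bar>g t\<bar> * \<bar>u t - c\<bar>"
    and start: "u s \<noteq> c"
  shows "u t \<noteq> c"
proof
  assume "u t = c"
  define I where "I = {min s t..max s t}"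
  have "bounded (g ` I)"
    unfolding I_def
    by (intro compact_imp_bounded compact_continuous_image continuous_on_subset[OF g]) auto
  then obtain C where C: "\<And>x. x \<in> I \<Longrightarrow> \<bar>g x\<bar> \<le> C"
    by (auto simp: bounded_iff)
  have "u s - c = 0"
  proof (rule zero_spreads_if_deriv_le_self[where f = "\<lambda>x. u x - c"])
    show "((\<lambda>x. u x - c) has_real_derivative u' x) (at x)" for x
      using DERIV_diff[OF der DERIV_const] by simp
    show "\<bar>u' x\<bar> \<le> C * \<bar>u x - c\<bar>" if "x \<in> {min s t..max s t}" for x
      using bound[of x] mult_right_mono[OF C, of x "\<bar>u x - c\<bar>"] that
      by (auto simp: I_def)
  qed (use \<open>u t = c\<close> in auto)
  then show False using start by simp
qed

section \<open>The logistic equation\<close>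

lemma logistic_eq_closed_form:
  fixes a b k :: real
  assumes k: "0 < k"
    and der: "\<And>t. (u has_real_derivative (u t - a) * (b - u t) / k) (at t)"
    and between: "\<And>t. a < u t" "\<And>t. u t < b"
    and mid: "u 0 = (a + b) / 2"
  shows "u t = (a + b * exp ((b - a) * t / k)) / (1 + exp ((b - a) * t / k))"
proof -
  define E where "E = exp ((b - a) * t / k)"
  have "((\<lambda>t. ln (u t - a) - ln (b - u t) - (b - a) * t / k) has_real_derivative 0) (at t)" for t
  proof -
    have "((\<lambda>t. ln (u t - a) - ln (b - u t) - (b - a) * t / k) has_real_derivative
       (u t - a) * (b - u t) / k / (u t - a) + (u t - a) * (b - u t) / k / (b - u t)
         - (b - a) / k) (at t)"
      using between[of t] k by (auto intro!: derivative_eq_intros der)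
    moreover have "(u t - a) * (b - u t) / k / (u t - a) = (b - u t) / k"
      "(u t - a) * (b - u t) / k / (b - u t) = (u t - a) / k"
      using between[of t] by simp_all
    then have "(u t - a) * (b - u t) / k / (u t - a)
        + (u t - a) * (b - u t) / k / (b - u t) - (b - a) / k = 0"
      by (simp add: diff_divide_distrib)
    ultimately show ?thesis by simp
  qed
  then have "ln (u t - a) - ln (b - u t) - (b - a) * t / k
      = ln (u 0 - a) - ln (b - u 0) - (b - a) * 0 / k"
    by (intro DERIV_isconst_all) blast
  also have "\<dots> = 0"
    by (simp add: mid field_simps)
  finally have "ln (u t - a) = ln (b - u t) + (b - a) * t / k"
    by simp
  then have "exp (ln (u t - a)) = exp (ln (b - u t)) * E"
    by (simp add: exp_add E_def)
  then have "u t - a = (b - u t) * E"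
    using between[of t] by simp
  moreover have "1 + E > 0"
    by (simp add: E_def add_pos_pos)
  ultimately show ?thesis
    unfolding E_def[symmetric] by (simp add: field_simps)
qed

lemma logistic_closed_form_between:
  fixes a b s :: real
  assumes "a < b"
  shows "a < (a + b * exp s) / (1 + exp s)" "(a + b * exp s) / (1 + exp s) < b"
proof -
  have "1 + exp s > 0" by (simp add: add_pos_pos)
  then show "a < (a + b * exp s) / (1 + exp s)" "(a + b * exp s) / (1 + exp s) < b"
    using assms by (simp_all add: field_simps)
qed

lemma logistic_closed_form_has_derivative:
  fixes a b k :: real
  assumes u: "\<And>t. u t = (a + b * exp ((b - a) * t / k)) / (1 + exp ((b - a) * t / k))"
    and k: "0 < k"
  shows "(u has_real_derivative (u t - a) * (b - u t) / k) (at t)"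
proof -
  define E where "E = exp ((b - a) * t / k)"
  have E: "1 + E > 0" by (simp add: E_def add_pos_pos)
  have "((\<lambda>t. (a + b * exp ((b - a) * t / k)) / (1 + exp ((b - a) * t / k)))
      has_real_derivative
      ((b * (E * ((b - a) / k))) * (1 + E) - (a + b * E) * (E * ((b - a) / k)))
        / ((1 + E) * (1 + E))) (at t)"
    unfolding E_def
    by (rule derivative_eq_intros refl | use E k in \<open>simp add: E_def\<close>)+
  moreover have "u = (\<lambda>t. (a + b * exp ((b - a) * t / k)) / (1 + exp ((b - a) * t / k)))"
    by (rule ext) (rule u)
  moreover have "((b * (E * ((b - a) / k))) * (1 + E) - (a + b * E) * (E * ((b - a) / k)))
        / ((1 + E) * (1 + E)) = (u t - a) * (b - u t) / k"
  proof -
    have "u t - a = (b - a) * E / (1 + E)" "b - u t = (b - a) / (1 + E)"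
      using E unfolding u E_def[symmetric] by (simp_all add: field_simps)
    then have "(u t - a) * (b - u t) / k = ((b - a) * E * (b - a) / k) / ((1 + E) * (1 + E))"
      by simp
    also have "(b - a) * E * (b - a) / k
        = (b * (E * ((b - a) / k))) * (1 + E) - (a + b * E) * (E * ((b - a) / k))"
      using k by (simp add: field_simps)
    finally show ?thesis by simp
  qed
  ultimately show ?thesis by simp
qed

lemma logistic_closed_form_at_bot:
  fixes a b c :: real
  assumes "0 < c"
  shows "((\<lambda>t. (a + b * exp (c * t)) / (1 + exp (c * t))) \<longlongrightarrow> a) at_bot"
proof -
  have "filterlim (\<lambda>t. c * t) at_bot at_bot"
    using assms filterlim_ident by (subst filterlim_tendsto_pos_mult_at_bot_iff[OF tendsto_const])
  then have "((\<lambda>t. exp (c * t)) \<longlongrightarrow> 0) at_bot"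
    by (rule filterlim_compose[OF exp_at_bot])
  then have "((\<lambda>t. (a + b * exp (c * t)) / (1 + exp (c * t))) \<longlongrightarrow> (a + b * 0) / (1 + 0)) at_bot"
    by (intro tendsto_intros) simp_all
  then show ?thesis by simp
qed

text \<open>Reflecting time and exchanging the two limits leaves the profile invariant.\<close>

lemma logistic_closed_form_at_top:
  fixes a b c :: real
  assumes "0 < c"
  shows "((\<lambda>t. (a + b * exp (c * t)) / (1 + exp (c * t))) \<longlongrightarrow> b) at_top"
proof -
  have "((\<lambda>t. (b + a * exp (c * (- t))) / (1 + exp (c * (- t)))) \<longlongrightarrow> b) at_top"
    using logistic_closed_form_at_bot[OF assms] filterlim_uminus_at_bot_at_top
    by (rule filterlim_compose)
  moreover have "(b + a * exp (c * (- t))) / (1 + exp (c * (- t)))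
      = (a + b * exp (c * t)) / (1 + exp (c * t))" for t
  proof -
    have "1 + exp (c * t) > 0" by (simp add: add_pos_pos)
    then show ?thesis by (simp add: exp_minus divide_simps) (simp add: algebra_simps)
  qed
  ultimately show ?thesis by simp
qed

section \<open>The double-well potential\<close>

lemma double_well_has_derivative:
  fixes a b p :: real
  assumes "1 < p"
  shows "((\<lambda>x. \<bar>(x - a) * (x - b)\<bar> powr p / p) has_real_derivative
     p_flux p ((x - a) * (x - b)) * (2 * x - a - b)) (at x)"
  by (rule DERIV_chain2[OF has_derivative_abs_powr[OF assms]])
    (auto intro!: derivative_eq_intros)

text \<open>
  On a compact set the factor \<open>|x - y|\<^sup>1\<^sup>/\<^sup>2\<close> is bounded by a power of the diameter, so Lipschitz
  continuity of \<open>u'\<close> gives Hoelder continuity with any smaller exponent.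
\<close>

lemma C1_loc_Holder_half_if_second_derivative_bounded:
  assumes u: "\<And>t. (u has_real_derivative v t) (at t)"
    and v: "\<And>t. (v has_real_derivative w t) (at t)"
    and w: "\<And>t. \<bar>w t\<bar> \<le> M"
  shows "C1_loc_Holder (1/2) u"
  unfolding C1_loc_Holder_def
proof (intro conjI allI impI)
  show "u differentiable (at t)" for t
    using u by (auto simp: real_differentiable_def)
  fix K :: "real set"
  assume "compact K"
  have M: "0 \<le> M"
    using w[of 0] by linarith
  have lip: "\<bar>v x - v y\<bar> \<le> M * \<bar>x - y\<bar>" for x y
    using field_differentiable_bound[of UNIV v w M x y] v w by simp
  have "\<bar>deriv u x - deriv u y\<bar> \<le> M * diameter K powr (1/2) * \<bar>x - y\<bar> powr (1/2)"
    if "x \<in> K" "y \<in> K" for x y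
  proof -
    have "\<bar>x - y\<bar> \<le> diameter K"
      using diameter_bounded_bound[OF compact_imp_bounded[OF \<open>compact K\<close>] that]
      by (simp add: dist_real_def)
    then have "\<bar>x - y\<bar> powr (1/2) * \<bar>x - y\<bar> powr (1/2)
        \<le> diameter K powr (1/2) * \<bar>x - y\<bar> powr (1/2)"
      by (intro mult_right_mono powr_mono2) auto
    then have "\<bar>x - y\<bar> \<le> diameter K powr (1/2) * \<bar>x - y\<bar> powr (1/2)"
      by (simp flip: powr_add)
    then have "M * \<bar>x - y\<bar> \<le> M * (diameter K powr (1/2) * \<bar>x - y\<bar> powr (1/2))"
      using M by (rule mult_left_mono)
    then show ?thesis
      using lip[of x y] by (simp add: DERIV_imp_deriv[OF u] mult.assoc)
  qed
  then show "\<exists>C. \<forall>x\<in>K. \<forall>y\<in>K. \<bar>deriv u x - deriv u y\<bar> \<le> C * \<bar>x - y\<bar> powr (1/2)"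
    by blast
qed

text \<open>
  With \<open>P = (u - a)(b - u)\<close> the flux is \<open>(P/k)\<^sup>p\<^sup>-\<^sup>1\<close>. Its derivative along the logistic equation is
  \<open>(p - 1)/k\<^sup>p P\<^sup>p\<^sup>-\<^sup>1 (a + b - 2 u)\<close>, which equals \<open>V'(u)\<close> precisely when \<open>k\<^sup>p = p - 1\<close>.
\<close>

lemma logistic_imp_p_Laplace_solution:
  fixes a b k p :: real
  assumes p: "1 < p" and k: "0 < k" "k powr p = p - 1"
    and der: "\<And>t. (u has_real_derivative (u t - a) * (b - u t) / k) (at t)"
    and between: "\<And>t. a < u t" "\<And>t. u t < b"
  shows "p_Laplace_solution p (\<lambda>x. \<bar>(x - a) * (x - b)\<bar> powr p / p) u"
proof -
  define P where "P = (\<lambda>t. (u t - a) * (b - u t))"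
  have P: "0 < P t" for t
    using between by (simp add: P_def)
  have P': "(P has_real_derivative P t / k * (a + b - 2 * u t)) (at t)" for t
    unfolding P_def using k(1)
    by (auto intro!: derivative_eq_intros der simp: field_simps)
  have du: "deriv u = (\<lambda>t. P t / k)"
    using DERIV_imp_deriv[OF der] by (auto simp: P_def)
  have "C1_loc_Holder (1/2) u"
  proof (rule C1_loc_Holder_half_if_second_derivative_bounded)
    show "(u has_real_derivative P t / k) (at t)" for t
      using der by (simp add: P_def)
    show "((\<lambda>t. P t / k) has_real_derivative P t / k * (a + b - 2 * u t) / k) (at t)" for t
      by (rule DERIV_cdivide[OF P'])
    have "P t * \<bar>a + b - 2 * u t\<bar> \<le> (b - a) * (b - a) * (b - a)" for t
      using between[of t] unfolding P_def
      by (intro mult_mono) auto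
    then show "\<bar>P t / k * (a + b - 2 * u t) / k\<bar> \<le> (b - a) * (b - a) * (b - a) / k / k" for t
      using k(1) P[of t] by (simp add: abs_mult divide_right_mono)
  qed
  moreover have F': "((\<lambda>t. p_flux p (deriv u t)) has_real_derivative
      P t powr (p - 1) * (a + b - 2 * u t)) (at t)" for t
  proof -
    have "p_flux p (deriv u t) = P t powr (p - 1) / k powr (p - 1)" for t
      using P[of t] k(1) by (simp add: du p_flux_pos powr_divide)
    moreover have "((\<lambda>t. P t powr (p - 1) / k powr (p - 1)) has_real_derivative
        (p - 1) * P t powr (p - 1 - 1) * (P t / k * (a + b - 2 * u t)) / k powr (p - 1)) (at t)"
      using P[of t] by (intro DERIV_cdivide) (auto intro!: derivative_eq_intros P')
    moreover have "(p - 1) * P t powr (p - 1 - 1) * (P t / k * (a + b - 2 * u t)) / k powr (p - 1)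
        = P t powr (p - 1) * (a + b - 2 * u t)"
    proof -
      have Pp: "P t powr (p - 1 - 1) = P t powr (p - 1) / P t"
        using P[of t] powr_diff[of "P t" "p - 1" 1] by simp
      have kp: "k * k powr (p - 1) = p - 1"
        using k powr_mult_base[of k "p - 1"] by simp
      have "(p - 1) * P t powr (p - 1 - 1) * (P t / k * (a + b - 2 * u t)) / k powr (p - 1)
          = (p - 1) / (k * k powr (p - 1)) * (P t powr (p - 1) * (a + b - 2 * u t))"
        unfolding Pp using P[of t] k(1) by (simp add: field_simps)
      then show ?thesis using kp p by simp
    qed
    ultimately show ?thesis by simp
  qed
  moreover have "deriv (\<lambda>x. \<bar>(x - a) * (x - b)\<bar> powr p / p) (u t)
      = P t powr (p - 1) * (a + b - 2 * u t)" for t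
  proof -
    have "(u t - a) * (u t - b) = - P t"
      by (simp add: P_def algebra_simps)
    moreover have "p_flux p (- P t) = - (P t powr (p - 1))"
      using P[of t] by (simp add: p_flux_minus p_flux_pos)
    moreover have "- c * (2 * u t - a - b) = c * (a + b - 2 * u t)" for c
      by (simp add: algebra_simps)
    ultimately show ?thesis
      using DERIV_imp_deriv[OF double_well_has_derivative[OF p, of a b "u t"]] by simp
  qed
  ultimately show ?thesis
    unfolding p_Laplace_solution_def
    using DERIV_imp_deriv[OF F'] F'
    by (auto intro: exI[of _ "1/2::real"] simp: real_differentiable_def)
qed

text \<open>
  The sign of \<open>u'\<close> is read off from the flux, which has the same sign and is continuous because it
  is differentiable. A negative sign would keep \<open>u\<close> above the midpoint for negative times,
  contradicting the limit at \<open>-\<infinity>\<close>.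
\<close>

lemma transition_solution_imp_logistic:
  fixes a b k p :: real
  assumes p: "1 < p" and ab: "a < b" and k: "0 < k" "k powr p = p - 1"
    and sol: "transition_solution p (\<lambda>x. \<bar>(x - a) * (x - b)\<bar> powr p / p) a b u"
  shows "a < u t" "u t < b" "(u has_real_derivative (u t - a) * (b - u t) / k) (at t)"
proof -
  define V where "V = (\<lambda>x. \<bar>(x - a) * (x - b)\<bar> powr p / p)"
  have lap: "p_Laplace_solution p V u" and mid: "u 0 = (a + b) / 2"
    and bot: "(u \<longlongrightarrow> a) at_bot" and top: "(u \<longlongrightarrow> b) at_top"
    using sol by (simp_all add: transition_solution_def V_def)
  have V: "V differentiable (at x)" for x
    unfolding V_def using double_well_has_derivative[OF p] by (auto simp: real_differentiable_def)
  have der: "(u has_real_derivative deriv u t) (at t)" for t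
    using lap by (auto simp: p_Laplace_solution_def C1_loc_Holder_def
        DERIV_deriv_iff_real_differentiable)
  have cont: "continuous_on S u" for S
    using der DERIV_isCont continuous_at_imp_continuous_on by blast
  have speed: "\<bar>deriv u t\<bar> = \<bar>(u t - a) * (u t - b)\<bar> / k" for t
  proof -
    have "(p - 1) / p * \<bar>deriv u t\<bar> powr p = \<bar>(u t - a) * (u t - b)\<bar> powr p / p"
      using p_Laplace_first_integral[OF p V lap top, of t] p by (simp add: V_def)
    then have "k powr p * \<bar>deriv u t\<bar> powr p = \<bar>(u t - a) * (u t - b)\<bar> powr p"
      using p k by simp
    then have "(k * \<bar>deriv u t\<bar>) powr p = \<bar>(u t - a) * (u t - b)\<bar> powr p"
      using k by (simp add: powr_mult)
    then have "k * \<bar>deriv u t\<bar> = \<bar>(u t - a) * (u t - b)\<bar>"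
      using p k powr_less_mono2[of p "k * \<bar>deriv u t\<bar>" "\<bar>(u t - a) * (u t - b)\<bar>"]
        powr_less_mono2[of p "\<bar>(u t - a) * (u t - b)\<bar>" "k * \<bar>deriv u t\<bar>"]
      by (cases "k * \<bar>deriv u t\<bar>" "\<bar>(u t - a) * (u t - b)\<bar>" rule: linorder_cases) auto
    then show ?thesis using k by (simp add: field_simps)
  qed
  have "u t \<noteq> a" for t
    by (rule equilibrium_not_reached[OF der, of "\<lambda>t. (u t - b) / k" a 0])
      (use ab mid k speed in \<open>auto intro!: continuous_intros cont simp: abs_mult mult.commute\<close>)
  moreover have "u t \<noteq> b" for t
    by (rule equilibrium_not_reached[OF der, of "\<lambda>t. (u t - a) / k" b 0])
      (use ab mid k speed in \<open>auto intro!: continuous_intros cont simp: abs_mult mult.commute\<close>)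
  ultimately have avoid: "a \<notin> range u" "b \<notin> range u"
    by auto
  have conn: "connected (range u)"
    using connected_continuous_image[OF cont connected_UNIV] .
  have mid_in: "(a + b) / 2 \<in> range u"
    using mid by (metis rangeI)
  have lo: "a < u t" for t
    using connectedD_interval[OF conn, of "u t" "(a + b) / 2" a] avoid mid_in ab
    by (cases "u t \<le> a") auto
  have hi: "u t < b" for t
    using connectedD_interval[OF conn, of "(a + b) / 2" "u t" b] avoid mid_in ab
    by (cases "b \<le> u t") auto
  define F where "F = (\<lambda>t. p_flux p (deriv u t))"
  have "F differentiable (at t)" for t
    using lap by (simp add: p_Laplace_solution_def F_def)
  then have "continuous_on UNIV F"
    by (simp add: continuous_at_imp_continuous_on differentiable_imp_continuous_within)
  then have connF: "connected (range F)"
    using connected_continuous_image connected_UNIV by blast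
  have "deriv u t \<noteq> 0" for t
    using speed[of t] lo[of t] hi[of t] k by auto
  then have F0: "0 \<notin> range F"
    by (auto simp: F_def p_flux_eq_0_iff)
  have pos: "0 < deriv u t" for t
  proof (rule ccontr)
    assume "\<not> 0 < deriv u t"
    then have "F t \<le> 0"
      using p_flux_pos_iff[of p "deriv u t"] by (simp add: F_def)
    then have "F x \<le> 0" for x
      using connectedD_interval[OF connF, of "F t" "F x" 0] F0 by (cases "0 \<le> F x") auto
    then have neg: "deriv u x \<le> 0" for x
      using p_flux_pos_iff[of p "deriv u x"] by (simp add: F_def not_less[symmetric])
    have "u 0 \<le> u x" if "x \<le> 0" for x
      using DERIV_nonpos_imp_nonincreasing[OF that] der neg by blast
    then have "u 0 \<le> a"
      by (intro tendsto_lowerbound[OF bot]) (auto simp: eventually_at_bot_linorder)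
    then show False using lo[of 0] by simp
  qed
  show "a < u t" "u t < b" by (fact lo hi)+
  have "deriv u t = (u t - a) * (b - u t) / k"
    using speed[of t] pos[of t] lo[of t] hi[of t] by (simp add: abs_mult)
  then show "(u has_real_derivative (u t - a) * (b - u t) / k) (at t)"
    using der[of t] by simp
qed

theorem theorem1p4:
  fixes p \<alpha> \<beta> :: real and V q :: "real \<Rightarrow> real"
  assumes "1 < p" and "\<alpha> < \<beta>"
    and V: "\<And>t. V t = \<bar>(t - \<alpha>) * (t - \<beta>)\<bar> powr p / p"
    and q: "\<And>t. q t =
        (\<alpha> + \<beta> * exp ((\<beta> - \<alpha>) * t / (p - 1) powr (1 / p))) /
        (1 + exp ((\<beta> - \<alpha>) * t / (p - 1) powr (1 / p)))"
  shows "transition_solution p V \<alpha> \<beta> q \<and>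
         (\<forall>u. transition_solution p V \<alpha> \<beta> u \<longrightarrow> u = q)"
proof -
  define k where "k = (p - 1) powr (1 / p)"
  have k: "0 < k" "k powr p = p - 1"
    using \<open>1 < p\<close> by (simp_all add: k_def powr_powr)
  have V_eq: "V = (\<lambda>t. \<bar>(t - \<alpha>) * (t - \<beta>)\<bar> powr p / p)"
    using V by blast
  have q_eq: "q t = (\<alpha> + \<beta> * exp ((\<beta> - \<alpha>) * t / k)) / (1 + exp ((\<beta> - \<alpha>) * t / k))" for t
    by (simp add: q k_def)
  have between: "\<alpha> < q t" "q t < \<beta>" for t
    using logistic_closed_form_between[OF \<open>\<alpha> < \<beta>\<close>] by (simp_all add: q_eq)
  have rate: "0 < (\<beta> - \<alpha>) / k"
    using k \<open>\<alpha> < \<beta>\<close> by simp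
  have q_fun: "q = (\<lambda>t. (\<alpha> + \<beta> * exp ((\<beta> - \<alpha>) / k * t)) / (1 + exp ((\<beta> - \<alpha>) / k * t)))"
    by (rule ext) (simp add: q_eq)
  have "p_Laplace_solution p V q"
    unfolding V_eq
    by (rule logistic_imp_p_Laplace_solution[OF \<open>1 < p\<close> k
          logistic_closed_form_has_derivative[OF q_eq k(1)] between])
  moreover have "q 0 = (\<alpha> + \<beta>) / 2"
    by (simp add: q_eq)
  moreover have "(q \<longlongrightarrow> \<alpha>) at_bot" "(q \<longlongrightarrow> \<beta>) at_top"
    unfolding q_fun
    by (rule logistic_closed_form_at_bot[OF rate], rule logistic_closed_form_at_top[OF rate])
  ultimately have "transition_solution p V \<alpha> \<beta> q"
    by (simp add: transition_solution_def)
  moreover have "u = q" if u: "transition_solution p V \<alpha> \<beta> u" for u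
  proof
    fix t
    note logistic = transition_solution_imp_logistic[OF \<open>1 < p\<close> \<open>\<alpha> < \<beta>\<close> k u[unfolded V_eq]]
    have "u 0 = (\<alpha> + \<beta>) / 2"
      using u by (simp add: transition_solution_def)
    then show "u t = q t"
      unfolding q_eq by (intro logistic_eq_closed_form k(1) logistic)
  qed
  ultimately show ?thesis by blast
qed

end
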